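(* For every constant $0<c\le 1/3$ we have, as $n\to\infty$, \[g(n;3,cn)\ge\frac{n^2}{2}\,(c-o(1)).\]
   Context: A red/blue/purple colouring of $K_n$ is a partition $R\cup B\cup P$ of its edge set. For integers $s,t\ge2$ and $n<R(s,t)$, $g(n;s,t)$ is the largest integer $g$ such that some red/blue/purple colouring of $K_n$ has $|P|=g$, $R\cup P$ is $K_s$-free and $B\cup P$ is $K_t$-free; for non-integer arguments $g(n;s,t):=g(n;\lceil s\rceil,\lceil t\rceil)$. *)

theory Defs
  imports Complex_Main "HOL-Library.Ramsey" "HOL-Library.Landau_Symbols"
begin

text \<open>Graphs on \<open>{..<n}\<close> are given by their edge sets, i.e. by subsets of \<open>[{..<n}]\<^bsup>2\<^esup>\<close>,
  the edge set of \<open>K\<^sub>n\<close>.\<close>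

definition ramsey_number :: "nat \<Rightarrow> nat \<Rightarrow> nat" where
  "ramsey_number s t = (LEAST N. partn_lst {..<N} [s, t] 2)"

definition K_free :: "nat \<Rightarrow> nat \<Rightarrow> nat set set \<Rightarrow> bool" where
  "K_free n k E \<longleftrightarrow> \<not> (\<exists>W \<in> [{..<n}]\<^bsup>k\<^esup>. clique W E)"

definition rbp_colouring :: "nat \<Rightarrow> nat set set \<Rightarrow> nat set set \<Rightarrow> nat set set \<Rightarrow> bool" where
  "rbp_colouring n R B P \<longleftrightarrow>
     R \<union> B \<union> P = [{..<n}]\<^bsup>2\<^esup> \<and> R \<inter> B = {} \<and> R \<inter> P = {} \<and> B \<inter> P = {}"

definition purple_counts :: "nat \<Rightarrow> nat \<Rightarrow> nat \<Rightarrow> nat set" where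
  "purple_counts n s t =
     {card P | R B P. rbp_colouring n R B P \<and> K_free n s (R \<union> P) \<and> K_free n t (B \<union> P)}"

text \<open>Only meaningful for \<open>n < ramsey_number s t\<close>; otherwise the maximum is over the empty set.\<close>

definition g_int :: "nat \<Rightarrow> nat \<Rightarrow> nat \<Rightarrow> nat" where
  "g_int n s t = Max (purple_counts n s t)"

definition g :: "nat \<Rightarrow> real \<Rightarrow> real \<Rightarrow> nat" where
  "g n s t = g_int n (nat \<lceil>s\<rceil>) (nat \<lceil>t\<rceil>)"

lemma finite_purple_counts: "finite (purple_counts n s t)"
proof (rule finite_subset)
  show "purple_counts n s t \<subseteq> card ` Pow ([{..<n}]\<^bsup>2\<^esup>)"
    unfolding purple_counts_def rbp_colouring_def by blast
  show "finite (card ` Pow ([{..<n}]\<^bsup>2\<^esup>))"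
    by (simp add: finite_imp_finite_nsets)
qed

lemma purple_counts_nonempty:
  assumes "n < ramsey_number s t"
  shows "purple_counts n s t \<noteq> {}"
proof -
  have "\<not> partn_lst {..<n} [s, t] 2"
    using assms not_less_Least unfolding ramsey_number_def by blast
  then obtain f :: "nat set \<Rightarrow> nat" where f: "f \<in> [{..<n}]\<^bsup>2\<^esup> \<rightarrow> {..<2}"
    and no: "\<And>i. i < 2 \<Longrightarrow> \<not> monochromatic {..<n} ([s, t] ! i) 2 f i"
    unfolding partn_lst_def by (auto simp: numeral_2_eq_2)
  define C where "C = (\<lambda>i. {e \<in> [{..<n}]\<^bsup>2\<^esup>. f e = i})"
  have free: "K_free n ([s, t] ! i) (C i)" if "i < 2" for i
    unfolding K_free_def
  proof
    assume "\<exists>W \<in> [{..<n}]\<^bsup>([s, t] ! i)\<^esup>. clique W (C i)"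
    then obtain W where W: "W \<in> [{..<n}]\<^bsup>([s, t] ! i)\<^esup>" "clique W (C i)" by blast
    have "f ` [W]\<^bsup>2\<^esup> \<subseteq> {i}"
    proof
      fix y assume "y \<in> f ` [W]\<^bsup>2\<^esup>"
      then obtain e where e: "e \<in> [W]\<^bsup>2\<^esup>" "y = f e" by blast
      then obtain v w where "e = {v, w}" "v \<in> W" "w \<in> W" "v \<noteq> w"
        by (auto simp: nsets_def card_2_iff)
      with W(2) have "e \<in> C i" by (simp add: clique_def)
      then show "y \<in> {i}" using e by (simp add: C_def)
    qed
    with W(1) no[OF that] show False unfolding monochromatic_def by blast
  qed
  have "rbp_colouring n (C 0) (C 1) {}"
    unfolding rbp_colouring_def C_def using f by (fastforce simp: less_2_cases_iff)
  moreover have "K_free n s (C 0 \<union> {})" "K_free n t (C 1 \<union> {})"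
    using free[of 0] free[of 1] by simp_all
  ultimately show ?thesis unfolding purple_counts_def by blast
qed

end

theory Submission
  imports Defs
begin

text \<open>
  Place the vertices on the cycle \<open>\<int>/n\<close> and let \<open>d\<close> be slightly smaller than \<open>c n\<close>. Join two vertices
  if their difference is within \<open>d / 2\<close> of \<open>n / 2\<close>. Each vertex has about \<open>d\<close> such neighbours, and the ends
  of a path of two such edges are at cyclic distance less than \<open>d\<close>. So no triangle arises when we add
  a sparse triangle-free red graph all of whose edges have cyclic length at least \<open>d\<close> and delete the
  few antipodal edges whose ends have a common red neighbour; the remaining antipodal edges are purple.

  The red graph has to meet every set of \<open>\<lceil>c n\<rceil>\<close> vertices. Since \<open>d \<le> n / 3\<close>, points pairwise at distance
  less than \<open>d\<close> lie on an arc with \<open>d\<close> points, and robustly so: every such set spans a positive proportion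
  of all pairs at distance at least \<open>d\<close>. Hence the red edges can be chosen greedily: as long as degrees
  stay bounded, few pairs are forbidden, so some permitted pair lies in a constant fraction of the
  sets not yet met, and after \<open>O(n)\<close> steps none of the at most \<open>2\<^sup>n\<close> sets is left.
\<close>

subsection \<open>A greedy choice of a sparse triangle-free graph\<close>

text \<open>Double counting of the pairs \<open>(e, W)\<close> with \<open>Q e W\<close>: there are
  at least \<open>h * card U\<close> of them, spread over at most \<open>N\<close> elements of
  \<open>A\<close>, so some \<open>e\<close> receives at least the average.\<close>

lemma exists_frequent_element:
  fixes h N :: real
  assumes "finite A" "finite U" "U \<noteq> {}" "0 < h" "real (card A) \<le> N"
    and "\<And>W. W \<in> U \<Longrightarrow> h \<le> real (card {e \<in> A. Q e W})"
  shows "\<exists>e\<in>A. h * real (card U) \<le> N * real (card {W \<in> U. Q e W})"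
proof (rule ccontr)
  assume "\<not> ?thesis"
  then have *: "\<And>e. e \<in> A \<Longrightarrow> N * real (card {W \<in> U. Q e W}) < h * real (card U)"
    by force
  have swap: "(\<Sum>e\<in>A. card {W \<in> U. Q e W}) = (\<Sum>W\<in>U. card {e \<in> A. Q e W})"
    using assms(1,2) by (rule sum_multicount_gen[OF _ _ ballI[OF refl]])
  have "h * real (card U) \<le> (\<Sum>W\<in>U. real (card {e \<in> A. Q e W}))"
    using sum_mono[of U "\<lambda>_. h" "\<lambda>W. real (card {e \<in> A. Q e W})"] assms(6) by (simp add: mult.commute)
  also have "\<dots> = (\<Sum>e\<in>A. real (card {W \<in> U. Q e W}))"
    using swap by (simp flip: of_nat_sum)
  finally have le: "h * real (card U) \<le> (\<Sum>e\<in>A. real (card {W \<in> U. Q e W}))" .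
  have pos: "0 < h * real (card U)"
    using assms by (simp add: card_gt_0_iff)
  then have "A \<noteq> {}" using le by auto
  then have N: "0 < N" using assms(1,5) by (metis card_gt_0_iff of_nat_0_less_iff less_le_trans)
  have "N * (h * real (card U)) \<le> (\<Sum>e\<in>A. N * real (card {W \<in> U. Q e W}))"
    using le N by (simp add: sum_distrib_left[symmetric])
  also have "\<dots> < (\<Sum>e\<in>A. h * real (card U))"
    using * \<open>A \<noteq> {}\<close> assms(1) by (intro sum_strict_mono) auto
  also have "\<dots> \<le> N * (h * real (card U))"
    using assms(5) pos by (simp add: mult_right_mono)
  finally show False by simp
qed

lemma card_relation_eq_sum:
  assumes "finite V" "E \<subseteq> V \<times> V"
  shows "card E = (\<Sum>v\<in>V. card (E `` {v}))"
proof -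
  have "E = Sigma V (\<lambda>v. E `` {v})" using assms by auto
  moreover have "finite (E `` {v})" for v
    using assms by (meson finite_Image finite_SigmaI finite_subset)
  ultimately show ?thesis using assms by (metis card_SigmaI)
qed

lemma card_relcomp_image_le:
  assumes "finite E" "\<And>v. card (E `` {v}) \<le> \<Delta>"
  shows "card ((E O E) `` {x}) \<le> \<Delta>\<^sup>2"
proof -
  have "(E O E) `` {x} = (\<Union>y\<in>E `` {x}. E `` {y})" by auto
  also have "card \<dots> \<le> (\<Sum>y\<in>E `` {x}. card (E `` {y}))"
    using assms(1) by (intro card_UN_le) auto
  also have "\<dots> \<le> card (E `` {x}) * \<Delta>"
    using assms(2) by (metis sum_bounded_above of_nat_id)
  also have "\<dots> \<le> \<Delta>\<^sup>2" using assms(2) by (simp add: power2_eq_square)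
  finally show ?thesis .
qed

text \<open>Each step adds one edge in both orientations, hence the bound \<open>2 * j\<close>.
  Permitted pairs avoid vertices of full degree and ends of paths of length two. The condition on
  \<open>h\<close> leaves in every set not yet met at least a proportion \<open>\<beta>\<close> of
  all ordered pairs. The cap \<open>m\<close> on the number of steps keeps that condition fixed
  during the induction.\<close>

lemma greedy_triangle_free:
  fixes \<beta> h :: real
  assumes V: "finite V" and F: "F \<subseteq> V \<times> V" "sym F" "irrefl F"
    and "finite \<F>" and dense: "\<And>W. W \<in> \<F> \<Longrightarrow> h \<le> real (card (F \<inter> W \<times> W))"
    and \<beta>: "0 < \<beta>" "\<beta> \<le> 1" and "0 < \<Delta>" "V \<noteq> {}"
    and h: "\<beta> * (real (card V))\<^sup>2 + 4 * real m * real (card V) / real \<Delta>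
              + real (card V) * (real \<Delta>)\<^sup>2 \<le> h"
    and "j \<le> m"
  shows "\<exists>E \<subseteq> F. sym E \<and> (E O E) \<inter> E = {} \<and> (\<forall>v. card (E `` {v}) \<le> \<Delta>) \<and> card E \<le> 2 * j \<and>
     real (card {W \<in> \<F>. E \<inter> W \<times> W = {}}) \<le> (1 - \<beta>) ^ j * real (card \<F>)"
  using \<open>j \<le> m\<close>
proof (induction j)
  case 0
  show ?case by (rule exI[of _ "{}"]) (auto simp: sym_def)
next
  case (Suc j)
  then obtain E where E: "E \<subseteq> F" "sym E" "(E O E) \<inter> E = {}" "\<And>v. card (E `` {v}) \<le> \<Delta>"
    "card E \<le> 2 * j" "real (card {W \<in> \<F>. E \<inter> W \<times> W = {}}) \<le> (1 - \<beta>) ^ j * real (card \<F>)"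
    by auto
  define U where "U = {W \<in> \<F>. E \<inter> W \<times> W = {}}"
  have finU: "finite U" using \<open>finite \<F>\<close> by (simp add: U_def)
  have EV: "E \<subseteq> V \<times> V" using E(1) F(1) by blast
  have finE: "finite E" using EV V by (meson finite_SigmaI finite_subset)
  have finF: "finite F" using F(1) V by (meson finite_SigmaI finite_subset)
  define n where "n = card V"
  have n: "0 < n" using V \<open>V \<noteq> {}\<close> by (simp add: n_def card_gt_0_iff)
  show ?case
  \<comment> \<open>Once every set is met, \<open>E\<close> is kept unchanged.\<close>
  proof (cases "U = {}")
    case True
    then have "real (card {W \<in> \<F>. E \<inter> W \<times> W = {}}) = 0" unfolding U_def
      by (metis card.empty of_nat_0)
    then have "real (card {W \<in> \<F>. E \<inter> W \<times> W = {}}) \<le> (1 - \<beta>) ^ Suc j * real (card \<F>)"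
      using \<beta> by simp
    moreover have "card E \<le> 2 * Suc j" using E(5) by simp
    ultimately show ?thesis using E(1-4) by blast
  next
    case False
    \<comment> \<open>\<open>S\<close> holds the saturated vertices. The degrees in \<open>E\<close>
      sum to at most \<open>2 * m\<close>, which bounds its size.\<close>
    define S where "S = {v \<in> V. card (E `` {v}) \<ge> \<Delta>}"
    have finS: "finite S" and SV: "S \<subseteq> V" using V by (auto simp: S_def)
    have "card S * \<Delta> \<le> (\<Sum>v\<in>S. card (E `` {v}))"
      using sum_mono[of S "\<lambda>_. \<Delta>" "\<lambda>v. card (E `` {v})"] by (simp add: S_def)
    also have "\<dots> \<le> (\<Sum>v\<in>V. card (E `` {v}))"
      using V by (intro sum_mono2) (auto simp: S_def)
    also have "\<dots> = card E" using card_relation_eq_sum[OF V EV] by simp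
    also have "\<dots> \<le> 2 * m" using E(5) Suc.prems by linarith
    finally have "real (card S * \<Delta>) \<le> real (2 * m)" by linarith
    then have S: "real (card S) \<le> 2 * real m / real \<Delta>"
      using \<open>0 < \<Delta>\<close> by (simp add: field_simps)
    \<comment> \<open>A forbidden pair either touches a saturated vertex or would close a triangle
      with two edges of \<open>E\<close>.\<close>
    define bad where "bad = S \<times> V \<union> V \<times> S \<union> (E O E)"
    have EOV: "E O E \<subseteq> V \<times> V" using EV by blast
    have "card (E O E) = (\<Sum>v\<in>V. card ((E O E) `` {v}))"
      by (rule card_relation_eq_sum[OF V EOV])
    also have "\<dots> \<le> n * \<Delta>\<^sup>2"
      using sum_bounded_above[of V "\<lambda>v. card ((E O E) `` {v})" "\<Delta>\<^sup>2"]
        card_relcomp_image_le[OF finE E(4)] by (simp add: n_def)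
    finally have EO: "card (E O E) \<le> n * \<Delta>\<^sup>2" .
    have finbad: "finite bad" unfolding bad_def using finS V finE by (simp add: finite_relcomp)
    have "card bad \<le> card (S \<times> V) + card (V \<times> S) + card (E O E)"
      unfolding bad_def by (meson add_mono card_Un_le le_trans order_refl)
    also have "\<dots> \<le> 2 * card S * n + n * \<Delta>\<^sup>2" using EO by (simp add: card_cartesian_product n_def)
    finally have "real (card bad) \<le> real (2 * card S * n + n * \<Delta>\<^sup>2)" by linarith
    also have "\<dots> = 2 * real n * real (card S) + real n * (real \<Delta>)\<^sup>2" by simp
    also have "\<dots> \<le> 2 * real n * (2 * real m / real \<Delta>) + real n * (real \<Delta>)\<^sup>2"
      using S by (intro add_right_mono mult_left_mono) auto
    finally have bad: "real (card bad) \<le> h - \<beta> * (real n)\<^sup>2"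
      using h by (simp add: n_def mult.assoc mult.commute mult.left_commute)
    \<comment> \<open>Averaging over at most \<open>n\<close> squared candidates gives a pair lying
      inside a fraction \<open>\<beta>\<close> of the sets not yet met.\<close>
    have "\<exists>e\<in>F - bad. (\<beta> * (real n)\<^sup>2) * real (card U) \<le> (real n)\<^sup>2 * real (card {W \<in> U. e \<in> W \<times> W})"
    proof (rule exists_frequent_element)
      show "0 < \<beta> * (real n)\<^sup>2" using \<beta> n by simp
      have "card (F - bad) \<le> card (V \<times> V)" using F V by (intro card_mono) auto
      then show "real (card (F - bad)) \<le> (real n)\<^sup>2"
        by (metis card_cartesian_product n_def of_nat_le_iff of_nat_power power2_eq_square)
    next
      fix W assume "W \<in> U"
      then have "h \<le> real (card (F \<inter> W \<times> W))" using dense by (simp add: U_def)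
      moreover have "card (F \<inter> W \<times> W) \<le> card ({e \<in> F - bad. e \<in> W \<times> W} \<union> bad)"
        using finF finbad by (intro card_mono) auto
      then have "card (F \<inter> W \<times> W) \<le> card {e \<in> F - bad. e \<in> W \<times> W} + card bad"
        by (meson card_Un_le le_trans)
      ultimately show "\<beta> * (real n)\<^sup>2 \<le> real (card {e \<in> F - bad. e \<in> W \<times> W})"
        using bad by linarith
    qed (use finF finU False in auto)
    then obtain x y where xy: "(x, y) \<in> F" "(x, y) \<notin> bad"
      and freq0: "(\<beta> * (real n)\<^sup>2) * real (card U) \<le> (real n)\<^sup>2 * real (card {W \<in> U. (x, y) \<in> W \<times> W})"
      by auto
    have freq: "\<beta> * real (card U) \<le> real (card {W \<in> U. (x, y) \<in> W \<times> W})"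
    proof -
      have "(real n)\<^sup>2 * (\<beta> * real (card U)) \<le> (real n)\<^sup>2 * real (card {W \<in> U. (x, y) \<in> W \<times> W})"
        using freq0 by (simp add: mult_ac)
      then show ?thesis using n by (simp add: mult_le_cancel_left)
    qed
    have yxF: "(y, x) \<in> F" using F(2) xy(1) by (meson symD)
    have ne: "x \<noteq> y" using F(3) xy(1) by (auto simp: irrefl_def)
    have xyV: "x \<in> V" "y \<in> V" using xy(1) F(1) by auto
    have deg: "card (E `` {x}) < \<Delta>" "card (E `` {y}) < \<Delta>"
      using xy(2) xyV by (auto simp: bad_def S_def)
    have nopath: "(x, z) \<notin> E \<or> (z, y) \<notin> E" for z
      using xy(2) by (auto simp: bad_def)
    define E' where "E' = E \<union> {(x, y), (y, x)}"
    have "E' \<subseteq> F" using E(1) xy(1) yxF by (simp add: E'_def)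
    moreover have "sym E'" using E(2) by (auto simp: E'_def sym_def)
    \<comment> \<open>A new triangle would consist of the new edge and a path of two old edges from
      \<open>x\<close> to \<open>y\<close>, which \<open>nopath\<close> excludes. Closed walks
      \<open>a = c\<close> are harmless because there are no loops.\<close>
    moreover have "(E' O E') \<inter> E' = {}"
    proof -
      have s: "(a, b) \<in> E \<longleftrightarrow> (b, a) \<in> E" for a b using E(2) by (meson symD)
      have irr: "(a, a) \<notin> E" for a using E(1) F(3) by (auto simp: irrefl_def)
      have tf: "(a, b) \<in> E \<Longrightarrow> (b, c) \<in> E \<Longrightarrow> (a, c) \<notin> E" for a b c using E(3) by blast
      have "(a, c) \<notin> E'" if E2: "(a, b) \<in> E'" "(b, c) \<in> E'" for a b c
      proof -
        consider "(a, b) \<in> E" "(b, c) \<in> E" | "(a, b) \<in> E" "b = x" "c = y"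
          | "(a, b) \<in> E" "b = y" "c = x" | "a = x" "b = y" "(b, c) \<in> E"
          | "a = y" "b = x" "(b, c) \<in> E" | "a = c"
          using E2 by (auto simp: E'_def)
        then show ?thesis
        proof cases
          case 1
          then show ?thesis using tf[OF 1] nopath[of b] s[of a b] s[of b c] by (auto simp: E'_def)
        next
          case 2
          then show ?thesis using nopath[of a] irr[of x] s[of a x] ne by (auto simp: E'_def)
        next
          case 3
          then show ?thesis using nopath[of a] irr[of y] s[of a x] ne by (auto simp: E'_def)
        next
          case 4
          then show ?thesis using nopath[of c] irr[of y] s[of c y] ne by (auto simp: E'_def)
        next
          case 5
          then show ?thesis using nopath[of c] irr[of x] s[of c y] ne by (auto simp: E'_def)
        next
          case 6
          then show ?thesis using irr ne by (auto simp: E'_def)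
        qed
      qed
      then show ?thesis by blast
    qed
    moreover have "card (E' `` {v}) \<le> \<Delta>" for v
    proof -
      have "E' `` {v} = (if v = x then insert y (E `` {v}) else if v = y then insert x (E `` {v}) else E `` {v})"
        using ne by (auto simp: E'_def)
      then show ?thesis
        using deg E(4)[of v] finE by (auto simp: card_insert_if)
    qed
    moreover have "card E' \<le> 2 * Suc j"
    proof -
      have "card E' \<le> card E + card {(x, y), (y, x)}" unfolding E'_def by (rule card_Un_le)
      also have "\<dots> \<le> card E + 2" using card_length[of "[(x, y), (y, x)]"] by simp
      finally show ?thesis using E(5) by simp
    qed
    moreover have "real (card {W \<in> \<F>. E' \<inter> W \<times> W = {}}) \<le> (1 - \<beta>) ^ Suc j * real (card \<F>)"
    proof -
      have "{W \<in> \<F>. E' \<inter> W \<times> W = {}} = U - {W \<in> U. (x, y) \<in> W \<times> W}"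
        by (auto simp: U_def E'_def)
      then have "real (card {W \<in> \<F>. E' \<inter> W \<times> W = {}}) = real (card U) - real (card {W \<in> U. (x, y) \<in> W \<times> W})"
        using finU by (simp add: card_Diff_subset of_nat_diff card_mono)
      also have "\<dots> \<le> (1 - \<beta>) * real (card U)" using freq by (simp add: algebra_simps)
      also have "\<dots> \<le> (1 - \<beta>) * ((1 - \<beta>) ^ j * real (card \<F>))"
        using E(6) \<beta> by (intro mult_left_mono) (auto simp: U_def)
      finally show ?thesis by (simp add: mult.assoc)
    qed
    ultimately show ?thesis by blast
  qed
qed

subsection \<open>Pairs of vertices on a cycle\<close>

lemma exists_lowest_elements:
  fixes S :: "'a::linorder set"
  assumes "finite S" "k \<le> card S"
  shows "\<exists>L \<subseteq> S. card L = k \<and> (\<forall>l\<in>L. \<forall>s\<in>S - L. l < s)"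
  using assms(2)
proof (induction k)
  case 0
  show ?case by (rule exI[of _ "{}"]) auto
next
  case (Suc k)
  then obtain L where L: "L \<subseteq> S" "card L = k" "\<forall>l\<in>L. \<forall>s\<in>S - L. l < s" by auto
  have fin: "finite L" "finite (S - L)" using L(1) assms(1) by (auto intro: finite_subset)
  have ne: "S - L \<noteq> {}" using L Suc.prems by auto
  define a where "a = Min (S - L)"
  have a: "a \<in> S - L" unfolding a_def using fin(2) ne by (rule Min_in)
  have "a < s" if "s \<in> S - insert a L" for s
    using that fin unfolding a_def by (metis DiffE DiffI Min_le insertCI order_le_imp_less_or_eq)
  then show ?case
    using L a fin by (intro exI[of _ "insert a L"]) auto
qed

lemma exists_highest_elements:
  fixes S :: "'a::linorder set"
  assumes "finite S" "k \<le> card S"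
  shows "\<exists>H \<subseteq> S. card H = k \<and> (\<forall>h\<in>H. \<forall>s\<in>S - H. s < h)"
proof -
  obtain L where L: "L \<subseteq> S" "card L = card S - k" "\<forall>l\<in>L. \<forall>s\<in>S - L. l < s"
    using exists_lowest_elements[OF assms(1), of "card S - k"] by auto
  have "card (S - L) = k"
    using L assms by (simp add: card_Diff_subset finite_subset)
  then show ?thesis using L by (intro exI[of _ "S - L"]) auto
qed

text \<open>With the \<open>k\<close> lowest and the \<open>k\<close> highest elements taken off, at
  least \<open>d\<close> elements of \<open>S\<close> remain, and all lie strictly between each
  \<open>l\<close> and \<open>h\<close>. For integers this forces the gap.\<close>

lemma exists_separated_subsets:
  fixes S :: "int set"
  assumes "finite S" "d + 2 * k \<le> card S"
  shows "\<exists>L H. L \<subseteq> S \<and> H \<subseteq> S \<and> card L = k \<and> card H = k \<and> (\<forall>l\<in>L. \<forall>h\<in>H. l + int d \<le> h)"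
proof -
  obtain L where L: "L \<subseteq> S" "card L = k" "\<forall>l\<in>L. \<forall>s\<in>S - L. l < s"
    using exists_lowest_elements[OF assms(1), of k] assms(2) by auto
  have cL: "card (S - L) = card S - k" using L assms by (simp add: card_Diff_subset finite_subset)
  obtain H where H: "H \<subseteq> S - L" "card H = k" "\<forall>h\<in>H. \<forall>s\<in>S - L - H. s < h"
    using exists_highest_elements[of "S - L" k] assms cL
    by (metis add_leD2 finite_Diff le_diff_conv2 mult_2 trans_le_add2 add.assoc)
  have "card (S - L - H) = card S - k - k"
    using H cL assms by (simp add: card_Diff_subset finite_subset)
  then have mid: "d \<le> card (S - L - H)" using assms(2) by simp
  have "l + int d \<le> h" if "l \<in> L" "h \<in> H" for l h
  proof -
    have "l < h" using L H that by blast
    have "S - L - H \<subseteq> {l<..<h}" using L H that by auto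
    then have "card (S - L - H) \<le> card {l<..<h}" by (intro card_mono) auto
    then show ?thesis using mid \<open>l < h\<close> by simp
  qed
  then show ?thesis using L H by (intro exI[of _ L] exI[of _ H]) auto
qed

section \<open>Cyclic distances as residues modulo \<open>n\<close>\<close>

text \<open>Pairs at cyclic distance at least \<open>d\<close>: the two bounds measure the two ways
  round the cycle. Graphs are kept as relations on ordered pairs, so each edge counts twice.\<close>

definition far_pairs :: "nat \<Rightarrow> nat \<Rightarrow> (nat \<times> nat) set" where
  "far_pairs n d = {(x, y) \<in> {..<n} \<times> {..<n}.
     int d \<le> (int x - int y) mod int n \<and> (int x - int y) mod int n \<le> int n - int d}"

text \<open>The distance of the residue from \<open>n / 2\<close> is doubled, which keeps everything
  in the integers for either parity of \<open>n\<close>.\<close>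

definition antipodal_pairs :: "nat \<Rightarrow> nat \<Rightarrow> (nat \<times> nat) set" where
  "antipodal_pairs n d = {(x, y) \<in> {..<n} \<times> {..<n}.
     \<bar>2 * ((int x - int y) mod int n) - int n\<bar> < int d}"

lemma diff_mod_swap:
  "((y::int) - x) mod n = (if (x - y) mod n = 0 then 0 else n - (x - y) mod n)"
  using zmod_zminus1_eq_if[of "x - y" n] by simp

lemma sym_far_pairs: "0 < d \<Longrightarrow> sym (far_pairs n d)"
proof (rule symI)
  fix x y assume "0 < d" "(x, y) \<in> far_pairs n d"
  then show "(y, x) \<in> far_pairs n d"
    by (auto simp: far_pairs_def diff_mod_swap[of "int y" "int x"])
qed

lemma irrefl_far_pairs: "0 < d \<Longrightarrow> irrefl (far_pairs n d)"
  by (auto simp: far_pairs_def irrefl_def)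

text \<open>Swapping the ends sends a residue \<open>r\<close> to \<open>n - r\<close>, a reflection
  about \<open>n / 2\<close>, except for \<open>r = 0\<close>, which \<open>d \<le> n\<close> rules
  out.\<close>

lemma sym_antipodal_pairs:
  assumes "d \<le> n"
  shows "sym (antipodal_pairs n d)"
proof (rule symI)
  fix x y assume *: "(x, y) \<in> antipodal_pairs n d"
  then have "(int x - int y) mod int n \<noteq> 0"
    using assms by (auto simp: antipodal_pairs_def)
  then show "(y, x) \<in> antipodal_pairs n d"
    using * by (auto simp: antipodal_pairs_def diff_mod_swap[of "int y" "int x"])
qed

text \<open>A residue within \<open>d / 2\<close> of \<open>n / 2\<close> exceeds
  \<open>(n - d) / 2\<close>, which is at least \<open>d\<close>; the upper bound is
  symmetric.\<close>

lemma antipodal_pairs_subset_far_pairs: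
  "3 * d \<le> n \<Longrightarrow> antipodal_pairs n d \<subseteq> far_pairs n d"
  by (auto simp: antipodal_pairs_def far_pairs_def)

text \<open>Two residues within \<open>d / 2\<close> of \<open>n / 2\<close> add up to within
  \<open>d\<close> of \<open>n\<close>, so \<open>x - z\<close> is congruent to some
  \<open>v\<close> of absolute value below \<open>d\<close>.\<close>

lemma antipodal_relcomp_not_far:
  assumes "(x, y) \<in> antipodal_pairs n d" "(y, z) \<in> antipodal_pairs n d" "d \<le> n"
  shows "(x, z) \<notin> far_pairs n d"
proof -
  define v where "v = (int x - int y) mod int n + (int y - int z) mod int n - int n"
  have v: "- int d < v" "v < int d"
    using assms by (auto simp: antipodal_pairs_def v_def)
  have "v mod int n = ((int x - int y) mod int n + (int y - int z) mod int n) mod int n"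
    unfolding v_def by (rule minus_mod_self2)
  also have "\<dots> = (int x - int z) mod int n"
    by (subst mod_add_eq) simp
  finally have xz: "(int x - int z) mod int n = v mod int n" by simp
  show ?thesis
  proof (cases "0 \<le> v")
    case True
    then have "v mod int n = v" using v assms(3) by (intro mod_pos_pos_trivial) auto
    then show ?thesis using v xz by (auto simp: far_pairs_def)
  next
    case False
    have "v mod int n = (v + int n) mod int n" by simp
    also have "\<dots> = v + int n"
      using False v assms(3) by (intro mod_pos_pos_trivial) auto
    finally show ?thesis using v xz by (auto simp: far_pairs_def)
  qed
qed

lemma card_antipodal_pairs_Image:
  assumes "d \<le> n" "x < n"
  shows "d - 1 \<le> card (antipodal_pairs n d `` {x})"
proof (cases "d = 0")
  case False
  \<comment> \<open>\<open>a\<close> is the least integer with \<open>2 * a > n - d\<close>. The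
    \<open>d - 1\<close> consecutive residues from \<open>a\<close> on are antipodal for either
    parity of \<open>n - d\<close>, and \<open>f\<close> turns a residue into the neighbour of
    \<open>x\<close> at that difference.\<close>
  define a where "a = (int n - int d) div 2 + 1"
  define f where "f = (\<lambda>m. nat ((int x - m) mod int n))"
  have a: "int n - int d < 2 * a" "2 * a \<le> int n - int d + 2" by (auto simp: a_def)
  have rng: "0 \<le> m \<and> m < int n \<and> \<bar>2 * m - int n\<bar> < int d" if "m \<in> {a..<a + int d - 1}" for m
    using that a assms False by auto
  have n: "0 < int n" using assms by simp
  have shift: "(int x - int (f m)) mod int n = m mod int n" for m
  proof -
    have "int (f m) = (int x - m) mod int n" using n by (simp add: f_def)
    then show ?thesis by (simp add: mod_diff_right_eq)
  qed
  have "inj_on f {a..<a + int d - 1}"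
  proof (rule inj_onI)
    fix m m' assume m: "m \<in> {a..<a + int d - 1}" "m' \<in> {a..<a + int d - 1}" "f m = f m'"
    then have "m mod int n = m' mod int n" using shift by metis
    then show "m = m'" using rng[OF m(1)] rng[OF m(2)] by simp
  qed
  moreover have "f ` {a..<a + int d - 1} \<subseteq> antipodal_pairs n d `` {x}"
  proof (rule image_subsetI)
    fix m assume m: "m \<in> {a..<a + int d - 1}"
    have "f m < n" using n by (simp add: f_def nat_less_iff)
    moreover have "(int x - int (f m)) mod int n = m" using shift rng[OF m] by simp
    ultimately show "f m \<in> antipodal_pairs n d `` {x}"
      using rng[OF m] assms by (auto simp: antipodal_pairs_def)
  qed
  moreover have "finite (antipodal_pairs n d `` {x})"
    by (rule finite_subset[of _ "{..<n}"]) (auto simp: antipodal_pairs_def)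
  ultimately have "card {a..<a + int d - 1} \<le> card (antipodal_pairs n d `` {x})"
    by (metis card_image card_mono)
  then show ?thesis by simp
qed simp

text \<open>Either each point of \<open>W\<close> has \<open>k\<close> far partners in
  \<open>W\<close>, and summing degrees suffices, or some \<open>w\<close> has fewer. In that case,
  without these partners at least \<open>d + 2 * k\<close> points remain, all within distance less
  than \<open>d\<close> of \<open>w\<close>. On this arc the \<open>k\<close> first and the
  \<open>k\<close> last points are pairwise far.\<close>

lemma many_far_pairs:
  assumes "0 < d" "3 * d \<le> n" "W \<subseteq> {..<n}" "d + 3 * k \<le> card W"
  shows "k\<^sup>2 \<le> card (far_pairs n d \<inter> W \<times> W)"
proof -
  let ?F = "far_pairs n d"
  have finW: "finite W" using assms(3) finite_subset by blast
  show ?thesis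
  proof (cases "\<forall>w\<in>W. k \<le> card ((?F \<inter> W \<times> W) `` {w})")
    case True
    have "k\<^sup>2 \<le> card W * k" using assms(4) by (simp add: power2_eq_square)
    also have "\<dots> \<le> (\<Sum>w\<in>W. card ((?F \<inter> W \<times> W) `` {w}))"
      using True sum_mono[of W "\<lambda>_. k" "\<lambda>w. card ((?F \<inter> W \<times> W) `` {w})"] by simp
    also have "\<dots> = card (?F \<inter> W \<times> W)"
      by (rule card_relation_eq_sum[symmetric]) (use finW in auto)
    finally show ?thesis .
  next
    case False
    then obtain w where w: "w \<in> W" "card ((?F \<inter> W \<times> W) `` {w}) < k" by auto
    define N where "N = (?F \<inter> W \<times> W) `` {w}"
    have NW: "N \<subseteq> W" by (auto simp: N_def)
    have "card (W - N) = card W - card N" using NW finW by (simp add: card_Diff_subset finite_subset)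
    then have cN: "d + 2 * k \<le> card (W - N)" using w assms(4) by (simp add: N_def)
    \<comment> \<open>The rotation \<open>f\<close> puts \<open>w\<close> at position
      \<open>d\<close>, so that the arc around it lies in \<open>[0, 2d)\<close> without wrapping
      round and can be treated as a set of integers.\<close>
    define f where "f = (\<lambda>x. (int x - int w + int d) mod int n)"
    have n: "0 < int n" using assms by simp
    have fdiff: "(f x - f y) mod int n = (int x - int y) mod int n" for x y
      by (simp add: f_def mod_diff_eq)
    have finj: "inj_on f {..<n}"
    proof (rule inj_onI)
      fix x y assume xy: "x \<in> {..<n}" "y \<in> {..<n}" "f x = f y"
      then have "(int x - int y) mod int n = 0" using fdiff[of x y] by simp
      then have "int x mod int n = int y mod int n" by (simp add: mod_eq_dvd_iff mod_0_imp_dvd)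
      then show "x = y" using xy by simp
    qed
    have frng: "0 \<le> f x \<and> f x < 2 * int d" if x: "x \<in> W - N" for x
    proof -
      let ?r = "(int x - int w) mod int n"
      have xn: "x < n" "w < n" using x w assms(3) by auto
      have "(x, w) \<notin> ?F"
        using x w(1) sym_far_pairs[OF assms(1)] by (auto simp: N_def dest: symD)
      then have r: "?r < int d \<or> int n - int d < ?r" using xn by (auto simp: far_pairs_def)
      have rn: "0 \<le> ?r" "?r < int n" using n by simp_all
      have f: "f x = (?r + int d) mod int n" by (simp add: f_def mod_add_left_eq)
      show ?thesis
      proof (cases "?r < int d")
        case True
        then have "f x = ?r + int d" unfolding f using rn assms(2) by (intro mod_pos_pos_trivial) auto
        then show ?thesis using True rn by simp
      next
        case False
        have "f x = (?r + int d - int n) mod int n" unfolding f by (rule minus_mod_self2[symmetric])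
        also have "\<dots> = ?r + int d - int n"
          using False r rn(2) assms(1,2) by (intro mod_pos_pos_trivial; linarith)
        finally show ?thesis using rn False r assms(1) by simp
      qed
    qed
    have "card (f ` (W - N)) = card (W - N)"
      using finj assms(3) by (intro card_image) (auto intro: inj_on_subset)
    then obtain L H where LH: "L \<subseteq> f ` (W - N)" "H \<subseteq> f ` (W - N)" "card L = k" "card H = k"
      and sep: "\<And>l h. l \<in> L \<Longrightarrow> h \<in> H \<Longrightarrow> l + int d \<le> h"
      using exists_separated_subsets[of "f ` (W - N)" d k] finW cN by auto
    \<comment> \<open>Here \<open>h - l\<close> is at least \<open>d\<close> and below
      \<open>2 * d\<close>, hence at most \<open>n - d\<close> because
      \<open>3 * d \<le> n\<close>.\<close>
    have sub: "H \<times> L \<subseteq> map_prod f f ` (?F \<inter> W \<times> W)"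
    proof clarify
      fix h l assume hl: "h \<in> H" "l \<in> L"
      obtain x y where xy: "x \<in> W - N" "h = f x" "y \<in> W - N" "l = f y"
        using hl LH by blast
      have "l + int d \<le> h" using sep hl by blast
      have b: "0 \<le> l" "h < 2 * int d" using frng xy by auto
      have "(int x - int y) mod int n = (h - l) mod int n" using fdiff xy by simp
      also have "\<dots> = h - l"
        using b \<open>l + int d \<le> h\<close> assms(2) by (intro mod_pos_pos_trivial) auto
      finally have "(x, y) \<in> ?F"
        using b \<open>l + int d \<le> h\<close> assms(2,3) xy by (auto simp: far_pairs_def)
      then show "(h, l) \<in> map_prod f f ` (?F \<inter> W \<times> W)"
        using xy by (intro image_eqI[of _ _ "(x, y)"]) auto
    qed
    have fin: "finite (?F \<inter> W \<times> W)" using finW by simp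
    have "k\<^sup>2 = card (H \<times> L)" using LH by (simp add: card_cartesian_product power2_eq_square)
    also have "\<dots> \<le> card (map_prod f f ` (?F \<inter> W \<times> W))"
      using sub fin by (intro card_mono) auto
    also have "\<dots> \<le> card (?F \<inter> W \<times> W)" using fin by (rule card_image_le)
    finally show ?thesis .
  qed
qed

subsection \<open>The colouring\<close>

definition edges_of :: "('a \<times> 'a) set \<Rightarrow> 'a set set" where
  "edges_of E = (\<lambda>(x, y). {x, y}) ` E"

lemma doubleton_in_edges_of: "sym E \<Longrightarrow> {x, y} \<in> edges_of E \<longleftrightarrow> (x, y) \<in> E"
  unfolding edges_of_def by (auto simp: image_iff doubleton_eq_iff sym_def)

text \<open>The increasing orientations of the pairs map injectively to edges and make up at least
  half of \<open>E\<close>.\<close>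

lemma card_le_card_edges_of:
  fixes E :: "('a::linorder \<times> 'a) set"
  assumes "finite E" "sym E" "irrefl E"
  shows "card E \<le> 2 * card (edges_of E)"
proof -
  define A where "A = {(x, y) \<in> E. x < y}"
  have finA: "finite A" unfolding A_def using assms(1) by (rule finite_subset[rotated]) auto
  have "E \<subseteq> A \<union> A\<inverse>"
    using assms(2,3) by (auto simp: A_def irrefl_def dest: symD)
  then have "card E \<le> card (A \<union> A\<inverse>)" using finA by (intro card_mono) auto
  also have "\<dots> \<le> card A + card (A\<inverse>)" by (rule card_Un_le)
  finally have "card E \<le> 2 * card A" by simp
  moreover have "card A = card ((\<lambda>(x, y). {x, y}) ` A)"
    by (rule card_image[symmetric]) (auto simp: inj_on_def A_def doubleton_eq_iff)
  moreover have "\<dots> \<le> card (edges_of E)"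
    unfolding edges_of_def using assms(1) by (intro card_mono) (auto simp: A_def)
  ultimately show ?thesis by simp
qed

text \<open>Recolouring purple as red gives a two-colouring without the forbidden cliques. This
  shows that \<open>g\<close> is evaluated only where its maximum is over a nonempty set.\<close>

lemma less_ramsey_number:
  assumes "purple_counts n s t \<noteq> {}"
  shows "n < ramsey_number s t"
proof (rule ccontr)
  assume "\<not> ?thesis"
  moreover have "partn_lst {..<ramsey_number s t} [s, t] 2"
    unfolding ramsey_number_def using ramsey2_full by (rule LeastI)
  ultimately have pn: "partn_lst {..<n} [s, t] 2"
    by (meson not_less partn_lst_greater_resource)
  obtain R B P where RBP: "rbp_colouring n R B P" "K_free n s (R \<union> P)" "K_free n t (B \<union> P)"
    using assms by (auto simp: purple_counts_def)
  define f :: "nat set \<Rightarrow> nat" where "f e = (if e \<in> R \<union> P then 0 else 1)" for e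
  have "f \<in> [{..<n}]\<^bsup>2\<^esup> \<rightarrow> {..<2}" by (auto simp: f_def)
  then obtain i H where iH: "i < 2" "H \<in> [{..<n}]\<^bsup>([s, t] ! i)\<^esup>" "f ` [H]\<^bsup>2\<^esup> \<subseteq> {i}"
    using pn unfolding partn_lst_def monochromatic_def by (fastforce simp: numeral_2_eq_2)
  have HV: "H \<subseteq> {..<n}" using iH(2) by (simp add: nsets_def)
  have edge: "f {v, w} = i" "{v, w} \<in> R \<union> B \<union> P" if "v \<in> H" "w \<in> H" "v \<noteq> w" for v w
    using iH(3) that HV RBP(1) unfolding rbp_colouring_def by (auto simp: image_subset_iff)
  show False
  proof (cases "i = 0")
    case True
    then have "clique H (R \<union> P)"
      unfolding clique_def using edge(1) by (metis f_def zero_neq_one)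
    then show False using RBP(2) iH(2) True by (auto simp: K_free_def)
  next
    case False
    then have i: "i = 1" using iH(1) by simp
    then have "clique H (B \<union> P)"
      unfolding clique_def using edge f_def by (metis Un_iff zero_neq_one)
    then show False using RBP(3) iH(2) i by (auto simp: K_free_def)
  qed
qed

text \<open>Red is \<open>E\<close>; purple is what is left of the antipodal pairs after deleting
  \<open>E\<close> and the ends of two-edge paths in \<open>E\<close>; the rest is blue. Each vertex
  loses at most \<open>\<Delta>\<close> plus its square of its antipodal neighbours. The factor 2
  arises because degrees count every edge twice.\<close>

lemma purple_colouring_from_sparse_graph:
  assumes d: "0 < d" "3 * d \<le> n"
    and E: "E \<subseteq> far_pairs n d" "sym E" "(E O E) \<inter> E = {}" "\<And>v. card (E `` {v}) \<le> \<Delta>"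
    and hit: "\<And>W. W \<subseteq> {..<n} \<Longrightarrow> card W = t \<Longrightarrow> E \<inter> W \<times> W \<noteq> {}"
  shows "\<exists>p \<in> purple_counts n 3 t. n * (d - 1 - \<Delta> - \<Delta>\<^sup>2) \<le> 2 * p"
proof -
  let ?F = "far_pairs n d" and ?A = "antipodal_pairs n d"
  define Q where "Q = ?A - E - E O E"
  have AF: "?A \<subseteq> ?F" using antipodal_pairs_subset_far_pairs d(2) .
  have symA: "sym ?A" using d by (intro sym_antipodal_pairs) simp
  have FV: "?F \<subseteq> {..<n} \<times> {..<n}" by (auto simp: far_pairs_def)
  have finF: "finite ?F" using FV by (rule finite_subset) simp
  have finE: "finite E" using E(1) finF by (rule finite_subset)
  have symEE: "sym (E O E)" using E(2) by (auto simp: sym_def)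
  have symQ: "sym Q" using symA E(2) symEE unfolding Q_def sym_def by blast
  have irrF: "irrefl ?F" using d(1) by (rule irrefl_far_pairs)
  have QF: "Q \<subseteq> ?F" using AF by (auto simp: Q_def)
  have irrQ: "irrefl Q" using irrF QF by (auto simp: irrefl_def)
  have finQ: "finite Q" using QF finF by (rule finite_subset)
  define T where "T = E \<union> Q"
  have symT: "sym T" using E(2) symQ by (auto simp: T_def sym_def)
  have AA: "(x, z) \<notin> ?F" if "(x, y) \<in> ?A" "(y, z) \<in> ?A" for x y z
    using antipodal_relcomp_not_far[OF that] d by simp
  have tri: "(a, c) \<notin> T" if ab: "(a, b) \<in> T" and bc: "(b, c) \<in> T" for a b c
  proof
    assume ac: "(a, c) \<in> T"
    have sE: "(u, v) \<in> E \<Longrightarrow> (v, u) \<in> E" for u v using E(2) by (rule symD)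
    have sA: "(u, v) \<in> ?A \<Longrightarrow> (v, u) \<in> ?A" for u v using symA by (rule symD)
    have TF: "(u, v) \<in> T \<Longrightarrow> (u, v) \<in> ?F" for u v using E(1) QF by (auto simp: T_def)
    have two_A: False if "(u, v) \<in> ?A" "(v, w) \<in> ?A" "(u, w) \<in> T" for u v w
      using AA[OF that(1,2)] TF[OF that(3)] by simp
    have two_E: False if "(u, v) \<in> E" "(v, w) \<in> E" "(u, w) \<in> T" for u v w
      using that E(3) by (auto simp: T_def Q_def)
    have or: "(u, v) \<in> T \<Longrightarrow> (u, v) \<in> E \<or> (u, v) \<in> ?A" for u v by (auto simp: T_def Q_def)
    have ba: "(b, a) \<in> T" and cb: "(c, b) \<in> T" using ab bc symT by (auto dest: symD)
    \<comment> \<open>Three edges of two types: two of them agree. Two edges of \<open>E\<close>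
      contradict the definition of \<open>Q\<close> or the absence of triangles in \<open>E\<close>;
      two antipodal ones have ends that are not far, while all of \<open>T\<close> is far.\<close>
    consider "(a, b) \<in> E" "(b, c) \<in> E" | "(a, b) \<in> ?A" "(b, c) \<in> ?A"
      | "(a, b) \<in> E" "(a, c) \<in> E" | "(a, b) \<in> ?A" "(a, c) \<in> ?A"
      | "(b, c) \<in> E" "(a, c) \<in> E" | "(b, c) \<in> ?A" "(a, c) \<in> ?A"
      using or[OF ab] or[OF bc] or[OF ac] by blast
    then show False
    proof cases
      case 1 then show False using two_E ac by blast
    next
      case 2 then show False using two_A ac by blast
    next
      case 3 then show False using two_E[OF sE _ bc] by blast
    next
      case 4 then show False using two_A[OF sA _ bc] by blast
    next
      case 5 then show False using two_E[OF _ sE ab] by blast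
    next
      case 6 then show False using two_A[OF _ sA ab] by blast
    qed
  qed
  define R where "R = edges_of E"
  define P where "P = edges_of Q"
  define B where "B = [{..<n}]\<^bsup>2\<^esup> - R - P"
  have RPsub: "edges_of S \<subseteq> [{..<n}]\<^bsup>2\<^esup>" if "S \<subseteq> ?F" for S
    using that FV irrF by (fastforce simp: edges_of_def irrefl_def)
  have RP: "R \<inter> P = {}"
  proof -
    have False if e: "e \<in> R" "e \<in> P" for e
    proof -
      obtain x y where xy: "e = {x, y}" "(x, y) \<in> E" using e(1) by (auto simp: R_def edges_of_def)
      then have "(x, y) \<in> Q" using e(2) symQ by (simp add: P_def doubleton_in_edges_of)
      then show False using xy by (simp add: Q_def)
    qed
    then show ?thesis by blast
  qed
  have col: "rbp_colouring n R B P"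
    unfolding rbp_colouring_def B_def using RP RPsub[OF E(1)] RPsub[OF QF]
    by (auto simp: R_def P_def)
  have RPT: "R \<union> P = edges_of T" by (auto simp: R_def P_def T_def edges_of_def)
  have "K_free n 3 (R \<union> P)"
    unfolding K_free_def
  proof
    assume "\<exists>W\<in>[{..<n}]\<^bsup>3\<^esup>. clique W (R \<union> P)"
    then obtain W where "card W = 3" "clique W (edges_of T)" by (auto simp: nsets_def RPT)
    then obtain a b c where "W = {a, b, c}" "a \<noteq> b" "b \<noteq> c" "a \<noteq> c"
      by (auto simp: card_3_iff)
    then have "(a, b) \<in> T" "(b, c) \<in> T" "(a, c) \<in> T"
      using \<open>clique W (edges_of T)\<close> symT by (auto simp: clique_def doubleton_in_edges_of)
    then show False using tri by blast
  qed
  moreover have "K_free n t (B \<union> P)"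
    unfolding K_free_def
  proof
    assume "\<exists>W\<in>[{..<n}]\<^bsup>t\<^esup>. clique W (B \<union> P)"
    then obtain W where W: "W \<subseteq> {..<n}" "card W = t" "clique W (B \<union> P)" by (auto simp: nsets_def)
    then obtain x y where xy: "(x, y) \<in> E" "x \<in> W" "y \<in> W" using hit by blast
    then have "x \<noteq> y" using irrF E(1) by (auto simp: irrefl_def)
    then have "{x, y} \<in> B \<union> P" using W(3) xy by (auto simp: clique_def)
    moreover have "{x, y} \<in> R" using xy(1) E(2) by (simp add: R_def doubleton_in_edges_of)
    ultimately show False using RP by (auto simp: B_def)
  qed
  ultimately have mem: "card P \<in> purple_counts n 3 t"
    using col unfolding purple_counts_def by blast
  have deg: "d - 1 - \<Delta> - \<Delta>\<^sup>2 \<le> card (Q `` {x})" if "x < n" for x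
  proof -
    have finI: "finite (S `` {x})" if "finite S" for S :: "(nat \<times> nat) set"
      using that by (rule finite_Image)
    have "?A `` {x} \<subseteq> Q `` {x} \<union> (E `` {x} \<union> (E O E) `` {x})" by (auto simp: Q_def)
    then have "card (?A `` {x}) \<le> card (Q `` {x} \<union> (E `` {x} \<union> (E O E) `` {x}))"
      using finQ finE by (intro card_mono) (auto intro!: finI finite_relcomp)
    also have "\<dots> \<le> card (Q `` {x}) + (card (E `` {x}) + card ((E O E) `` {x}))"
      by (meson add_left_mono card_Un_le le_trans)
    also have "\<dots> \<le> card (Q `` {x}) + (\<Delta> + \<Delta>\<^sup>2)"
      using E(4) card_relcomp_image_le[OF finE E(4)] by (intro add_left_mono add_mono)
    finally show ?thesis using card_antipodal_pairs_Image[of d n x] that d by linarith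
  qed
  have "n * (d - 1 - \<Delta> - \<Delta>\<^sup>2) \<le> (\<Sum>x<n. card (Q `` {x}))"
    using sum_mono[of "{..<n}" "\<lambda>_. d - 1 - \<Delta> - \<Delta>\<^sup>2" "\<lambda>x. card (Q `` {x})"] deg by simp
  also have "\<dots> = card Q"
    using QF FV by (intro card_relation_eq_sum[symmetric]) auto
  also have "\<dots> \<le> 2 * card P"
    unfolding P_def using finQ symQ irrQ by (rule card_le_card_edges_of)
  finally show ?thesis using mem by blast
qed

subsection \<open>Asymptotics\<close>

lemma eventually_g_ge:
  fixes c \<delta> :: real
  assumes c: "0 < c" "c \<le> 1 / 3" and "0 < \<delta>"
  shows "\<forall>\<^sub>F n in sequentially.
       n < ramsey_number 3 (nat \<lceil>c * real n\<rceil>) \<and>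
       real (g n 3 (c * real n)) \<ge> (real n)\<^sup>2 / 2 * (c - \<delta>)"
proof -
  \<comment> \<open>\<open>\<eta>\<close> is the unit of loss:
    \<open>8 * \<eta> \<le> \<delta>\<close> pays for all errors and
    \<open>8 * \<eta> \<le> c\<close> keeps \<open>d\<close> positive.\<close>
  define \<eta> where "\<eta> = min \<delta> c / 8"
  have \<eta>: "0 < \<eta>" "8 * \<eta> \<le> \<delta>" "8 * \<eta> \<le> c" "\<eta> \<le> 1"
    using c \<open>0 < \<delta>\<close> by (auto simp: \<eta>_def)
  \<comment> \<open>Every \<open>t\<close>-set will have at least
    \<open>\<eta>\<^sup>2 * n\<^sup>2 / 4\<close> far pairs. Half of this is reserved for
    \<open>\<beta>\<close>, a quarter for pairs at saturated vertices and a quarter for ends of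
    paths.\<close>
  define \<beta> where "\<beta> = \<eta>\<^sup>2 / 8"
  have \<eta>2: "0 < \<eta>\<^sup>2" "\<eta>\<^sup>2 \<le> \<eta>" "\<eta>\<^sup>2 \<le> 1"
    using \<eta> by (auto simp: power2_eq_square mult_left_le mult_le_one)
  have \<beta>: "0 < \<beta>" "\<beta> \<le> 1" using \<eta>2 by (auto simp: \<beta>_def)
  \<comment> \<open>After \<open>C * n\<close> greedy steps the proportion of sets not met is at
    most \<open>(1 / 3) ^ n\<close>, which beats the \<open>2 ^ n\<close> bound on their
    number.\<close>
  obtain C where C: "(1 - \<beta>) ^ C < 1 / 3"
    using real_arch_pow_inv[of "1 / 3" "1 - \<beta>"] \<beta> by auto
  define \<Delta> where "\<Delta> = nat \<lceil>64 * real C / \<eta>\<^sup>2\<rceil> + 1"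
  have \<Delta>: "0 < \<Delta>" "64 * real C / \<eta>\<^sup>2 \<le> real \<Delta>" unfolding \<Delta>_def by linarith+
  have \<Delta>C: "64 * real C \<le> \<eta>\<^sup>2 * real \<Delta>" using \<Delta>(2) \<eta>2 by (simp add: field_simps)
  define K where "K = (16 * (real \<Delta>)\<^sup>2 + real \<Delta> + 2) / \<eta>\<^sup>2"
  have main: "n < ramsey_number 3 (nat \<lceil>c * real n\<rceil>) \<and>
       real (g n 3 (c * real n)) \<ge> (real n)\<^sup>2 / 2 * (c - \<delta>)" if "K \<le> real n" for n
  proof -
    have n0: "16 * (real \<Delta>)\<^sup>2 + real \<Delta> + 2 \<le> \<eta>\<^sup>2 * real n"
      using that \<eta>2 by (simp add: K_def field_simps)
    have "\<eta>\<^sup>2 * real n \<le> \<eta> * real n" using \<eta>2 by (intro mult_right_mono) auto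
    then have n1: "16 * (real \<Delta>)\<^sup>2 + real \<Delta> + 2 \<le> \<eta> * real n" using n0 by linarith
    have D2: "0 \<le> (real \<Delta>)\<^sup>2" by simp
    have "\<eta> * real n \<noteq> 0" using n1 D2 by linarith
    then have npos: "0 < n" by (cases n) auto
    define k where "k = nat \<lfloor>\<eta> * real n\<rfloor>"
    define t where "t = nat \<lceil>c * real n\<rceil>"
    \<comment> \<open>Thus \<open>t = d + 3 * k\<close>, the size required by
      \<open>many_far_pairs\<close>.\<close>
    define d where "d = t - 3 * k"
    have k: "real k \<le> \<eta> * real n" "\<eta> * real n - 1 < real k" using \<eta>(1) by (auto simp: k_def)
    have t: "c * real n \<le> real t" "real t < c * real n + 1" using c(1) unfolding t_def by (simp_all, linarith)
    have ecn: "8 * (\<eta> * real n) \<le> c * real n"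
      using mult_right_mono[OF \<eta>(3), of "real n"] by simp
    have edn: "8 * (\<eta> * real n) \<le> \<delta> * real n"
      using mult_right_mono[OF \<eta>(2), of "real n"] by simp
    have c3: "3 * (c * real n) \<le> real n"
      using mult_right_mono[OF c(2), of "real n"] by simp
    have kt: "3 * k \<le> t"
    proof -
      have "real (3 * k) \<le> real t" using k t ecn n1 D2 by simp
      then show ?thesis by linarith
    qed
    then have dr: "real d = real t - 3 * real k" by (simp add: d_def of_nat_diff)
    have D1: "1 \<le> real \<Delta>" using \<Delta>(1) by linarith
    have k1: "1 \<le> real k" using k n1 D1 D2 by linarith
    have "0 < real d" using dr k t ecn n1 D2 by linarith
    then have d0: "0 < d" by simp
    \<comment> \<open>Rounding up may bring \<open>3 * t\<close> close to \<open>n + 3\<close>; the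
      subtracted \<open>9 * k\<close> with \<open>k \<ge> 1\<close> absorbs this.\<close>
    have "real (3 * d) \<le> real n" using dr t c3 k1 by simp
    then have d3: "3 * d \<le> n" by linarith
    let ?F = "far_pairs n d"
    define \<F> where "\<F> = {W. W \<subseteq> {..<n} \<and> card W = t}"
    have fin\<F>: "finite \<F>" by (simp add: \<F>_def)
    have "card \<F> \<le> card (Pow {..<n})" by (intro card_mono) (auto simp: \<F>_def)
    then have "real (card \<F>) \<le> real (2 ^ n)" by (simp add: card_Pow del: of_nat_power)
    then have card\<F>: "real (card \<F>) \<le> 2 ^ n" by simp
    have dense: "real (k\<^sup>2) \<le> real (card (?F \<inter> W \<times> W))" if "W \<in> \<F>" for W
      using many_far_pairs[OF d0 d3, of W k] that kt by (auto simp: \<F>_def d_def)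
    have h: "\<beta> * (real (card {..<n}))\<^sup>2 + 4 * real (C * n) * real (card {..<n}) / real \<Delta>
              + real (card {..<n}) * (real \<Delta>)\<^sup>2 \<le> real (k\<^sup>2)"
    proof -
      have 1: "4 * real (C * n) * real n / real \<Delta> \<le> \<eta>\<^sup>2 * (real n)\<^sup>2 / 16"
      proof -
        have "64 * real C * (real n)\<^sup>2 \<le> \<eta>\<^sup>2 * real \<Delta> * (real n)\<^sup>2"
          using \<Delta>C by (intro mult_right_mono) auto
        then show ?thesis using \<Delta>(1) by (simp add: field_simps power2_eq_square)
      qed
      have 2: "real n * (real \<Delta>)\<^sup>2 \<le> \<eta>\<^sup>2 * (real n)\<^sup>2 / 16"
      proof -
        have "real n * (16 * (real \<Delta>)\<^sup>2) \<le> real n * (\<eta>\<^sup>2 * real n)"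
          using n0 by (intro mult_left_mono) auto
        then show ?thesis by (simp add: power2_eq_square mult_ac)
      qed
      have 3: "\<eta>\<^sup>2 * (real n)\<^sup>2 / 4 \<le> real (k\<^sup>2)"
      proof -
        have "\<eta> * real n / 2 \<le> real k" using k n1 D2 by linarith
        then have "(\<eta> * real n / 2)\<^sup>2 \<le> (real k)\<^sup>2" using \<eta>(1) by (intro power_mono) auto
        then show ?thesis by (simp add: power_mult_distrib power_divide)
      qed
      have "\<beta> * (real n)\<^sup>2 = \<eta>\<^sup>2 * (real n)\<^sup>2 / 8" by (simp add: \<beta>_def)
      then show ?thesis using 1 2 3 by (simp only: card_lessThan)
    qed
    have "\<exists>E \<subseteq> ?F. sym E \<and> (E O E) \<inter> E = {} \<and> (\<forall>v. card (E `` {v}) \<le> \<Delta>) \<and>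
       card E \<le> 2 * (C * n) \<and>
       real (card {W \<in> \<F>. E \<inter> W \<times> W = {}}) \<le> (1 - \<beta>) ^ (C * n) * real (card \<F>)"
    proof (rule greedy_triangle_free[where V = "{..<n}" and h = "real (k\<^sup>2)" and m = "C * n"])
      show "?F \<subseteq> {..<n} \<times> {..<n}" by (auto simp: far_pairs_def)
      show "{..<n} \<noteq> {}" using npos by auto
    qed (use h dense fin\<F> \<beta> \<Delta>(1) sym_far_pairs[OF d0] irrefl_far_pairs[OF d0] in simp_all)
    then obtain E where E: "E \<subseteq> ?F" "sym E" "(E O E) \<inter> E = {}" "\<And>v. card (E `` {v}) \<le> \<Delta>"
      and unhit: "real (card {W \<in> \<F>. E \<inter> W \<times> W = {}}) \<le> (1 - \<beta>) ^ (C * n) * real (card \<F>)"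
      by blast
    \<comment> \<open>Fewer than one set remains, hence none.\<close>
    have "(1 - \<beta>) ^ (C * n) * real (card \<F>) \<le> (1 / 3) ^ n * 2 ^ n"
      unfolding power_mult using C \<beta> card\<F> by (intro mult_mono power_mono) auto
    also have "\<dots> = (2 / 3 :: real) ^ n" by (simp add: power_divide)
    also have "\<dots> < 1" using npos by (simp add: power_less_one_iff)
    finally have "card {W \<in> \<F>. E \<inter> W \<times> W = {}} = 0" using unhit by linarith
    then have "{W \<in> \<F>. E \<inter> W \<times> W = {}} = {}" using fin\<F> by simp
    then have hit: "\<And>W. W \<subseteq> {..<n} \<Longrightarrow> card W = t \<Longrightarrow> E \<inter> W \<times> W \<noteq> {}"
      unfolding \<F>_def by blast
    obtain p where p: "p \<in> purple_counts n 3 t" "n * (d - 1 - \<Delta> - \<Delta>\<^sup>2) \<le> 2 * p"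
      using purple_colouring_from_sparse_graph[OF d0 d3 E hit] by blast
    have "p \<le> g_int n 3 t"
      unfolding g_int_def using finite_purple_counts p(1) by (rule Max_ge)
    then have pg: "p \<le> g n 3 (c * real n)" by (simp add: g_def t_def)
    \<comment> \<open>Subtraction on naturals stops at 0, so it can only exceed the real
      difference.\<close>
    have "real d - 1 - real \<Delta> - (real \<Delta>)\<^sup>2 \<le> real (d - 1 - \<Delta> - \<Delta>\<^sup>2)"
    proof -
      have "int d - 1 - int \<Delta> - int (\<Delta>\<^sup>2) \<le> int (d - 1 - \<Delta> - \<Delta>\<^sup>2)" by linarith
      then have "real_of_int (int d - 1 - int \<Delta> - int (\<Delta>\<^sup>2)) \<le> real_of_int (int (d - 1 - \<Delta> - \<Delta>\<^sup>2))"
        by (simp only: of_int_le_iff)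
      then show ?thesis by simp
    qed
    \<comment> \<open>The term \<open>3 * k\<close> costs at most \<open>3 * \<eta> * n\<close> and
      the constants at most \<open>\<eta> * n\<close>, well within
      \<open>\<delta> * n\<close>.\<close>
    moreover have "(c - \<delta>) * real n \<le> real d - 1 - real \<Delta> - (real \<Delta>)\<^sup>2"
      using dr k t edn n1 D2 unfolding left_diff_distrib by linarith
    ultimately have "real n * ((c - \<delta>) * real n) \<le> real n * real (d - 1 - \<Delta> - \<Delta>\<^sup>2)"
      by (intro mult_left_mono) auto
    also have "\<dots> = real (n * (d - 1 - \<Delta> - \<Delta>\<^sup>2))" by simp
    also have "\<dots> \<le> real (2 * g n 3 (c * real n))" using p(2) pg by linarith
    finally have "(real n)\<^sup>2 / 2 * (c - \<delta>) \<le> real (g n 3 (c * real n))"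
      by (simp add: power2_eq_square mult_ac)
    moreover have "n < ramsey_number 3 t" using p(1) by (intro less_ramsey_number) auto
    ultimately show ?thesis by (simp add: t_def)
  qed
  have "\<forall>\<^sub>F n in sequentially. K \<le> real n"
    using filterlim_real_sequentially by (simp add: filterlim_at_top)
  then show ?thesis by (rule eventually_mono) (rule main)
qed

theorem theorem3p1:
  fixes c :: real
  assumes "0 < c" and "c \<le> 1 / 3"
  shows "\<exists>\<epsilon> :: nat \<Rightarrow> real. \<epsilon> \<in> o(\<lambda>_. 1) \<and>
    (\<forall>\<^sub>F n in sequentially.
       n < ramsey_number 3 (nat \<lceil>c * real n\<rceil>) \<and>
       real (g n 3 (c * real n)) \<ge> (real n)\<^sup>2 / 2 * (c - \<epsilon> n))"
proof -
  \<comment> \<open>\<open>\<epsilon>\<close> is the positive part of the deficit, so the lower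
    bound on \<open>g\<close> holds by definition for \<open>n > 0\<close> and only convergence
    needs \<open>eventually_g_ge\<close>.\<close>
  define \<epsilon> where "\<epsilon> n = max 0 (c - 2 * real (g n 3 (c * real n)) / (real n)\<^sup>2)" for n
  have "\<epsilon> \<longlonglongrightarrow> 0"
  proof (rule tendstoI)
    fix e :: real assume "0 < e"
    then have "\<forall>\<^sub>F n in sequentially. (real n)\<^sup>2 / 2 * (c - e / 2) \<le> real (g n 3 (c * real n))"
      using eventually_g_ge[OF assms, of "e / 2"] by (auto elim: eventually_mono)
    then show "\<forall>\<^sub>F n in sequentially. dist (\<epsilon> n) 0 < e"
      using eventually_gt_at_top[of 0]
    proof eventually_elim
      case (elim n)
      then have "c - 2 * real (g n 3 (c * real n)) / (real n)\<^sup>2 \<le> e / 2"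
        by (simp add: field_simps)
      then show ?case using \<open>0 < e\<close> by (simp add: \<epsilon>_def dist_real_def)
    qed
  qed
  then have "\<epsilon> \<in> o(\<lambda>_. 1)" by (intro smalloI_tendsto) auto
  moreover have "\<forall>\<^sub>F n in sequentially.
       n < ramsey_number 3 (nat \<lceil>c * real n\<rceil>) \<and>
       real (g n 3 (c * real n)) \<ge> (real n)\<^sup>2 / 2 * (c - \<epsilon> n)"
    \<comment> \<open>Any positive \<open>\<delta>\<close> would do here: only the Ramsey bound is
      taken from this instance.\<close>
    using eventually_g_ge[OF assms zero_less_one] eventually_gt_at_top[of 0]
  proof eventually_elim
    case (elim n)
    have "c - \<epsilon> n \<le> 2 * real (g n 3 (c * real n)) / (real n)\<^sup>2" by (simp add: \<epsilon>_def)
    then have "(real n)\<^sup>2 / 2 * (c - \<epsilon> n) \<le>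
        (real n)\<^sup>2 / 2 * (2 * real (g n 3 (c * real n)) / (real n)\<^sup>2)"
      by (intro mult_left_mono) auto
    also have "\<dots> = real (g n 3 (c * real n))" using elim by simp
    finally show ?case using elim by simp
  qed
  ultimately show ?thesis by blast
qed

end
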